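(* Let $G=(V,E)$ be a loopless strongly connected graph with bank vertex $\$\in V$, and let $U:=\{\mathbf{u}\in\mathbf{Z}^{V}:\ \mathbf{1}^{\dagger}\mathbf{u}=0\}$. Then $K(G)$ is the subgroup $U/Q^{\dagger}\mathbf{Z}^{V}$ of $\mathcal{K}(G)$, and the map $\mathbf{u}+Q^{\dagger}\mathbf{Z}^{V}\mapsto[\mathbf{u}]$ is a well-defined bijection from $K(G)$ onto the set of coevalence classes of critical configurations on $(G,\$)$.
   Context: A graph is a finite directed multigraph. For $G=(V,E)$, $A$ is the $V\times V$ matrix with $A_{vw}$ the number of directed edges from $v$ to $w$, $\Delta$ is diagonal with $\Delta_{vv}=\sum_wA_{vw}$ (outdegree), $Q=\Delta-A$, $\dagger$ denotes transpose, $\mathcal{K}(G)=\mathbf{Z}^V/Q^{\dagger}\mathbf{Z}^V$, and $K(G)$ is its torsion subgroup. $\hat v$ is the characteristic vector of $v$, $\mathbf{1}$ the all-ones vector. A configuration is $\mathbf{c}\in\mathbf{Z}^V$ with $\mathbf{1}^{\dagger}\mathbf{c}=0$. A vertex $v\neq\$$ is legal for $\mathbf{c}$ if $c(v)\ge\Delta_{vv}$; $\mathbf{c}$ is stable if $c(v)<\Delta_{vv}$ for all $v\ne\$$, and $\$$ is legal for $\mathbf{c}$ exactly when $\mathbf{c}$ is stable. Firing $v$ gives $\mathbf{c}|v:=\mathbf{c}-Q^{\dagger}\hat v$; a sequence $v_1\cdots v_k$ is legal for $\mathbf{c}$ if each $v_i$ is legal for $\mathbf{c}|v_1\cdots v_{i-1}$.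 $\mathcal{S}(\mathbf{c})$ is the set of configurations $\mathbf{c}|v_1\cdots v_k$ for legal sequences (possibly empty) not containing $\$$; it is known that $\mathcal{S}(\mathbf{c})$ contains a unique stable configuration, the stabilization $\overline{\mathbf{c}}$ of $\mathbf{c}$. For stable $\mathbf{c}$, the successor $\sigma(\mathbf{c})$ is the stabilization of $\mathbf{c}|\$$. A stable $\mathbf{c}$ is critical if $\sigma^k(\mathbf{c})=\mathbf{c}$ for some $k\ge1$. Critical $\mathbf{a},\mathbf{b}$ are coeval if $\sigma^m(\mathbf{a})=\mathbf{b}$ for some $m\ge0$; this is an equivalence relation on critical configurations. For any configuration $\mathbf{c}$, there is $m_0\ge0$ such that $\sigma^m(\overline{\mathbf{c}})$ is critical for all $m\ge m_0$, and these are all coeval; their coevalence class is denoted $[\mathbf{c}]$. *)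

theory Defs
  imports
    "HOL-Algebra.Product_Groups"
    "HOL-Algebra.Elementary_Groups"
    "Graph_Theory.Digraph_Component"
begin

text \<open>
  A finite directed multigraph is a \<open>fin_digraph\<close>. Elements of \<open>Z^V\<close> are extensional functions
  on \<open>verts G\<close> (they are \<open>undefined\<close> off \<open>verts G\<close>), which is what the carrier of
  \<open>product_group\<close> consists of; hence the restricted abstractions below.
\<close>

definition int_vectors :: "('a, 'b) pre_digraph \<Rightarrow> ('a \<Rightarrow> int) monoid" where
  "int_vectors G = product_group (verts G) (\<lambda>_. integer_group)"

definition char_vector :: "('a, 'b) pre_digraph \<Rightarrow> 'a \<Rightarrow> 'a \<Rightarrow> int" where
  "char_vector G v = (\<lambda>w\<in>verts G. if w = v then 1 else 0)"

definition adjacency :: "('a, 'b) pre_digraph \<Rightarrow> 'a \<Rightarrow> 'a \<Rightarrow> int" where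
  "adjacency G v w = int (card {e \<in> arcs G. tail G e = v \<and> head G e = w})"

definition degree_matrix :: "('a, 'b) pre_digraph \<Rightarrow> 'a \<Rightarrow> 'a \<Rightarrow> int" where
  "degree_matrix G v w = (if v = w then \<Sum>x\<in>verts G. adjacency G v x else 0)"

definition laplacian :: "('a, 'b) pre_digraph \<Rightarrow> 'a \<Rightarrow> 'a \<Rightarrow> int" where
  "laplacian G v w = degree_matrix G v w - adjacency G v w"

text \<open>The product of the transposed Laplacian with a vector, and the image of \<open>Z^V\<close> under it.\<close>

definition laplacian_transpose_mult ::
    "('a, 'b) pre_digraph \<Rightarrow> ('a \<Rightarrow> int) \<Rightarrow> 'a \<Rightarrow> int" where
  "laplacian_transpose_mult G x = (\<lambda>w\<in>verts G. \<Sum>v\<in>verts G. laplacian G v w * x v)"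

definition laplacian_lattice :: "('a, 'b) pre_digraph \<Rightarrow> ('a \<Rightarrow> int) set" where
  "laplacian_lattice G = laplacian_transpose_mult G ` carrier (int_vectors G)"

definition torsion_elements :: "('c, 'd) monoid_scheme \<Rightarrow> 'c set" where
  "torsion_elements H = {x \<in> carrier H. \<exists>n::nat. n > 0 \<and> x [^]\<^bsub>H\<^esub> n = \<one>\<^bsub>H\<^esub>}"

definition full_critical_group :: "('a, 'b) pre_digraph \<Rightarrow> ('a \<Rightarrow> int) set monoid" where
  "full_critical_group G = int_vectors G Mod laplacian_lattice G"

definition critical_group :: "('a, 'b) pre_digraph \<Rightarrow> ('a \<Rightarrow> int) set monoid" where
  "critical_group G =
     (full_critical_group G)\<lparr>carrier := torsion_elements (full_critical_group G)\<rparr>"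

definition configurations :: "('a, 'b) pre_digraph \<Rightarrow> ('a \<Rightarrow> int) set" where
  "configurations G = {c \<in> carrier (int_vectors G). (\<Sum>v\<in>verts G. c v) = 0}"

definition stable :: "('a, 'b) pre_digraph \<Rightarrow> 'a \<Rightarrow> ('a \<Rightarrow> int) \<Rightarrow> bool" where
  "stable G bank c \<longleftrightarrow> (\<forall>v\<in>verts G. v \<noteq> bank \<longrightarrow> c v < degree_matrix G v v)"

definition legal :: "('a, 'b) pre_digraph \<Rightarrow> 'a \<Rightarrow> ('a \<Rightarrow> int) \<Rightarrow> 'a \<Rightarrow> bool" where
  "legal G bank c v \<longleftrightarrow>
     v \<in> verts G \<and> (if v = bank then stable G bank c else degree_matrix G v v \<le> c v)"

definition fire :: "('a, 'b) pre_digraph \<Rightarrow> ('a \<Rightarrow> int) \<Rightarrow> 'a \<Rightarrow> 'a \<Rightarrow> int" where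
  "fire G c v = (\<lambda>w\<in>verts G. c w - laplacian_transpose_mult G (char_vector G v) w)"

definition legal_seq :: "('a, 'b) pre_digraph \<Rightarrow> 'a \<Rightarrow> ('a \<Rightarrow> int) \<Rightarrow> 'a list \<Rightarrow> bool" where
  "legal_seq G bank c vs \<longleftrightarrow>
     (\<forall>i<length vs. legal G bank (foldl (fire G) c (take i vs)) (vs ! i))"

definition reachable_without_bank ::
    "('a, 'b) pre_digraph \<Rightarrow> 'a \<Rightarrow> ('a \<Rightarrow> int) \<Rightarrow> ('a \<Rightarrow> int) set" where
  "reachable_without_bank G bank c =
     {foldl (fire G) c vs | vs. legal_seq G bank c vs \<and> bank \<notin> set vs}"

definition stabilization ::
    "('a, 'b) pre_digraph \<Rightarrow> 'a \<Rightarrow> ('a \<Rightarrow> int) \<Rightarrow> 'a \<Rightarrow> int" where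
  "stabilization G bank c =
     (THE d. d \<in> reachable_without_bank G bank c \<and> stable G bank d)"

definition successor ::
    "('a, 'b) pre_digraph \<Rightarrow> 'a \<Rightarrow> ('a \<Rightarrow> int) \<Rightarrow> 'a \<Rightarrow> int" where
  "successor G bank c = stabilization G bank (fire G c bank)"

definition critical :: "('a, 'b) pre_digraph \<Rightarrow> 'a \<Rightarrow> ('a \<Rightarrow> int) set" where
  "critical G bank =
     {c \<in> configurations G. stable G bank c \<and> (\<exists>k\<ge>1. (successor G bank ^^ k) c = c)}"

definition coeval :: "('a, 'b) pre_digraph \<Rightarrow> 'a \<Rightarrow> (('a \<Rightarrow> int) \<times> ('a \<Rightarrow> int)) set" where
  "coeval G bank =
     {(a, b). a \<in> critical G bank \<and> b \<in> critical G bank \<and> (\<exists>m. (successor G bank ^^ m) a = b)}"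

definition coevalence_classes :: "('a, 'b) pre_digraph \<Rightarrow> 'a \<Rightarrow> ('a \<Rightarrow> int) set set" where
  "coevalence_classes G bank = critical G bank // coeval G bank"

text \<open>The coevalence class that contains all sufficiently late iterated successors of the
  stabilization of \<open>c\<close>.\<close>

definition coevalence_class ::
    "('a, 'b) pre_digraph \<Rightarrow> 'a \<Rightarrow> ('a \<Rightarrow> int) \<Rightarrow> ('a \<Rightarrow> int) set" where
  "coevalence_class G bank c =
     (THE C. C \<in> coevalence_classes G bank \<and>
        (\<exists>m0. \<forall>m\<ge>m0. (successor G bank ^^ m) (stabilization G bank c) \<in> C))"

end

theory Submission
  imports Defs "HOL-Algebra.Multiplicative_Group"
begin

text \<open>
  The main point is that \<open>[c]\<close> does not change when an arbitrary vertex \<open>v\<close> fires, legally or not.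
  Firing a legal \<open>v\<close> other than the bank does not change the stabilization of \<open>c\<close>, and firing the
  bank, even when \<open>c\<close> is unstable, replaces this stabilization by its successor. If the bank keeps
  firing, chips spread along arcs until \<open>v\<close> becomes legal. Up to the first firing of \<open>v\<close> all these
  moves are still possible when \<open>v\<close> has fired in advance, since this only adds chips elsewhere; both
  orders of firing end in the same configuration. Hence \<open>[c]\<close> depends only on the coset of \<open>c\<close>;
  conversely firing never leaves a coset, so different cosets have different classes. Once every
  vertex has fired, all entries off the bank are nonnegative, so after stabilization each coset of
  sum-zero vectors meets a fixed finite set of configurations; thus there are finitely many of them
  and all are torsion.
\<close>

section \<open>Lists with prescribed counts\<close>

lemma count_list_replicate: "count_list (replicate n x) y = (if x = y then n else 0)"
  by (induction n) auto

text \<open>Turns a vector of firing counts into an actual firing list, so that integer combinations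
  of Laplacian rows can be carried out as firings.\<close>

lemma list_with_counts_exists:
  assumes "finite A"
  shows "\<exists>vs. set vs \<subseteq> A \<and> (\<forall>v\<in>A. count_list vs v = f v)"
  using assms
proof (induction A)
  case (insert a A)
  then obtain vs where vs: "set vs \<subseteq> A" "\<forall>v\<in>A. count_list vs v = f v"
    by blast
  have "count_list vs a = 0"
    using vs(1) insert.hyps(2) by (auto intro: count_notin)
  then have "set (replicate (f a) a @ vs) \<subseteq> insert a A \<and>
      (\<forall>v\<in>insert a A. count_list (replicate (f a) a @ vs) v = f v)"
    using vs insert.hyps(2) by (auto simp: count_list_replicate)
  then show ?case by blast
qed simp

lemma funpow_add_apply: "(f ^^ (m + n)) x = (f ^^ m) ((f ^^ n) x)"
  by (simp add: funpow_add)

section \<open>The Laplacian and the effect of firing\<close>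

locale chip_firing = fin_digraph G for G :: "('a, 'b) pre_digraph" +
  fixes bank :: 'a
  assumes strongly_connected: "strongly_connected G"
    and bank_in_verts: "bank \<in> verts G"
begin

abbreviation outdeg :: "'a \<Rightarrow> int" where
  "outdeg v \<equiv> degree_matrix G v v"

abbreviation fires :: "('a \<Rightarrow> int) \<Rightarrow> 'a list \<Rightarrow> 'a \<Rightarrow> int" where
  "fires \<equiv> foldl (fire G)"

lemma adjacency_nonneg: "adjacency G v w \<ge> 0"
  by (simp add: adjacency_def)

lemma adjacency_pos:
  assumes "v \<rightarrow>\<^bsub>G\<^esub> w"
  shows "adjacency G v w \<ge> 1"
proof -
  obtain e where "e \<in> arcs G" "tail G e = v" "head G e = w"
    using assms by (auto simp: arcs_ends_conv)
  then have "{e \<in> arcs G. tail G e = v \<and> head G e = w} \<noteq> {}"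
    by blast
  then have "card {e \<in> arcs G. tail G e = v \<and> head G e = w} > 0"
    by (simp add: card_gt_0_iff)
  then show ?thesis
    by (simp add: adjacency_def)
qed

lemma outdeg_nonneg: "outdeg v \<ge> 0"
  by (simp add: degree_matrix_def adjacency_nonneg sum_nonneg)

lemma laplacian_nonpos: "v \<noteq> w \<Longrightarrow> laplacian G v w \<le> 0"
  by (simp add: laplacian_def degree_matrix_def adjacency_nonneg)

lemma laplacian_diag_le: "laplacian G v v \<le> outdeg v"
  by (simp add: laplacian_def adjacency_nonneg)

lemma sum_laplacian_row:
  assumes "v \<in> verts G"
  shows "(\<Sum>w\<in>verts G. laplacian G v w) = 0"
  using assms by (simp add: laplacian_def degree_matrix_def sum_subtractf)

lemma laplacian_transpose_mult_char_vector:
  assumes "v \<in> verts G" "w \<in> verts G"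
  shows "laplacian_transpose_mult G (char_vector G v) w = laplacian G v w"
proof -
  have "laplacian_transpose_mult G (char_vector G v) w
      = (\<Sum>u\<in>verts G. laplacian G u w * (if u = v then 1 else 0))"
    using assms(2) by (simp add: laplacian_transpose_mult_def char_vector_def)
  also have "\<dots> = (\<Sum>u\<in>verts G. if u = v then laplacian G v w else 0)"
    by (rule sum.cong) auto
  finally show ?thesis
    using assms(1) by simp
qed

lemma fire_apply:
  assumes "v \<in> verts G" "w \<in> verts G"
  shows "fire G c v w = c w - laplacian G v w"
  using assms by (simp add: fire_def laplacian_transpose_mult_char_vector)

lemma fires_apply:
  assumes "set vs \<subseteq> verts G" "w \<in> verts G"
  shows "fires c vs w = c w - (\<Sum>v\<in>verts G. laplacian G v w * int (count_list vs v))"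
  using assms(1)
proof (induction vs arbitrary: c)
  case (Cons v vs)
  have "(\<Sum>u\<in>verts G. laplacian G u w * int (count_list (v # vs) u))
      = (\<Sum>u\<in>verts G. laplacian G u w * int (count_list vs u) + (if u = v then laplacian G v w else 0))"
    by (rule sum.cong) (auto simp: algebra_simps)
  also have "\<dots> = (\<Sum>u\<in>verts G. laplacian G u w * int (count_list vs u)) + laplacian G v w"
    using Cons.prems by (simp add: sum.distrib)
  finally show ?case
    using Cons assms(2) by (simp add: fire_apply)
qed simp

lemma fire_extensional [simp]: "fire G c v \<in> extensional (verts G)"
  by (simp add: fire_def)

lemma fires_extensional: "c \<in> extensional (verts G) \<Longrightarrow> fires c vs \<in> extensional (verts G)"
  by (induction vs arbitrary: c) auto

text \<open>The abelian property: by \<open>fires_apply\<close> a list acts only through its counts.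
  Every later exchange of firing orders rests on this.\<close>

lemma fires_cong_count:
  assumes "c \<in> extensional (verts G)" "set vs \<subseteq> verts G" "set ws \<subseteq> verts G"
    and "\<And>v. v \<in> verts G \<Longrightarrow> count_list vs v = count_list ws v"
  shows "fires c vs = fires c ws"
  by (rule extensionalityI[OF fires_extensional fires_extensional])
    (use assms in \<open>simp_all add: fires_apply cong: sum.cong\<close>)

lemma sum_fires:
  assumes "set vs \<subseteq> verts G"
  shows "(\<Sum>w\<in>verts G. fires c vs w) = (\<Sum>w\<in>verts G. c w)"
  using assms
  by (induction vs arbitrary: c) (simp_all add: fire_apply sum_subtractf sum_laplacian_row)

lemma fires_nondecreasing:
  assumes "set vs \<subseteq> verts G" "w \<in> verts G" "w \<notin> set vs"
  shows "fires c vs w \<ge> c w"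
  using assms
proof (induction vs arbitrary: c)
  case (Cons v vs)
  have "fire G c v w \<ge> c w"
    using Cons.prems laplacian_nonpos[of v w] by (auto simp: fire_apply)
  moreover have "fires (fire G c v) vs w \<ge> fire G c v w"
    using Cons by simp
  ultimately show ?case by simp
qed simp

text \<open>Each firing of \<open>u\<close> sends at least one chip along the arc, each firing of
  \<open>w\<close> costs at most \<open>outdeg w\<close>, and no other firing takes chips from
  \<open>w\<close>. Read one way, this bounds the firings of \<open>u\<close>; read the other way,
  it makes \<open>w\<close> rich once \<open>u\<close> fires often.\<close>

lemma fires_arc_lower_bound:
  assumes "set vs \<subseteq> verts G" "u \<rightarrow>\<^bsub>G\<^esub> w"
  shows "fires c vs w \<ge> c w + int (count_list vs u) - outdeg w * int (count_list vs w)"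
  using assms(1)
proof (induction vs arbitrary: c)
  case (Cons v vs)
  have w: "w \<in> verts G"
    using assms(2) by (rule adj_in_verts)
  \<comment> \<open>This includes \<open>v = u = w\<close>, where the arc is a loop that returns a
    chip to \<open>w\<close>.\<close>
  have "laplacian G v w \<le> (if v = w then outdeg w else 0) - (if v = u then 1 else 0)"
    using laplacian_nonpos[of v w] laplacian_diag_le[of v] adjacency_pos[OF assms(2)]
    by (auto simp: laplacian_def degree_matrix_def adjacency_nonneg)
  then have "fire G c v w \<ge> c w + (if v = u then 1 else 0) - (if v = w then outdeg w else 0)"
    using Cons.prems w by (simp add: fire_apply)
  moreover have "fires (fire G c v) vs w
      \<ge> fire G c v w + int (count_list vs u) - outdeg w * int (count_list vs w)"
    using Cons by simp
  ultimately show ?case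
    by (auto simp: algebra_simps split: if_splits)
qed simp

subsection \<open>Semilegal firing sequences\<close>

text \<open>Unlike in a legal sequence, the bank may fire at any time, even in an unstable configuration.
  This makes the condition monotone: raising the entries at the fired vertices preserves it.\<close>

fun semilegal :: "('a \<Rightarrow> int) \<Rightarrow> 'a list \<Rightarrow> bool" where
  "semilegal c [] \<longleftrightarrow> True"
| "semilegal c (v # vs) \<longleftrightarrow>
     v \<in> verts G \<and> (v \<noteq> bank \<longrightarrow> outdeg v \<le> c v) \<and> semilegal (fire G c v) vs"

lemma semilegal_append:
  "semilegal c (vs @ ws) \<longleftrightarrow> semilegal c vs \<and> semilegal (fires c vs) ws"
  by (induction vs arbitrary: c) auto

lemma semilegal_verts: "semilegal c vs \<Longrightarrow> set vs \<subseteq> verts G"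
  by (induction vs arbitrary: c) auto

lemma semilegal_mono:
  assumes "semilegal c vs" "\<And>v. v \<in> set vs \<Longrightarrow> v \<noteq> bank \<Longrightarrow> c v \<le> d v"
  shows "semilegal d vs"
  using assms
proof (induction vs arbitrary: c d)
  case (Cons v vs)
  have "fire G c v u \<le> fire G d v u" if "u \<in> set vs" "u \<noteq> bank" for u
  proof -
    have "u \<in> verts G"
      using that Cons.prems(1) semilegal_verts by fastforce
    then show ?thesis
      using that Cons.prems by (simp add: fire_apply)
  qed
  with Cons show ?case
    by (auto intro: order_trans Cons.IH)
qed simp

lemma legal_seq_Cons:
  "legal_seq G bank c (v # vs) \<longleftrightarrow> legal G bank c v \<and> legal_seq G bank (fire G c v) vs"
  unfolding legal_seq_def by (simp add: All_less_Suc2)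

lemma legal_seq_iff_semilegal:
  "bank \<notin> set vs \<Longrightarrow> legal_seq G bank c vs \<longleftrightarrow> semilegal c vs"
proof (induction vs arbitrary: c)
  case Nil
  then show ?case by (simp add: legal_seq_def)
next
  case (Cons v vs)
  then show ?case by (auto simp: legal_seq_Cons legal_def)
qed

lemma reachable_without_bank_eq:
  "reachable_without_bank G bank c = {fires c vs | vs. semilegal c vs \<and> bank \<notin> set vs}"
  unfolding reachable_without_bank_def using legal_seq_iff_semilegal by blast

text \<open>A vertex off the bank fires only if it can pay, so it ends at 0 or more; a vertex that
  does not fire loses nothing. An entry may start negative but never sinks further.\<close>

lemma fire_lower_bound:
  assumes "v \<in> verts G" "v \<noteq> bank \<longrightarrow> outdeg v \<le> c v" "w \<in> verts G" "w \<noteq> bank"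
  shows "fire G c v w \<ge> min (c w) 0"
  using assms laplacian_nonpos[of v w] laplacian_diag_le[of w] by (cases "v = w") (auto simp: fire_apply)

lemma semilegal_lower_bound:
  assumes "semilegal c vs" "w \<in> verts G" "w \<noteq> bank"
  shows "fires c vs w \<ge> min (c w) 0"
  using assms(1)
proof (induction vs arbitrary: c)
  case (Cons v vs)
  then show ?case
    using fire_lower_bound[of v c w] assms(2,3) by fastforce
qed simp

text \<open>One firing of \<open>w\<close> lifts its entry to at least 0, and
  \<open>semilegal_lower_bound\<close> keeps it there. Unlike \<open>min (c w) 0\<close>, this bound
  is independent of \<open>c\<close>.\<close>

lemma semilegal_nonneg:
  assumes "semilegal c vs" "w \<in> set vs" "w \<noteq> bank"
  shows "fires c vs w \<ge> 0"
proof -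
  obtain xs ys where vs: "vs = xs @ w # ys"
    using assms(2) split_list by fast
  have w: "w \<in> verts G"
    using assms semilegal_verts by blast
  have sl: "outdeg w \<le> fires c xs w" "semilegal (fire G (fires c xs) w) ys"
    using assms vs by (auto simp: semilegal_append)
  have "fire G (fires c xs) w w \<ge> 0"
    using sl(1) w laplacian_diag_le[of w] by (simp add: fire_apply)
  then show ?thesis
    using semilegal_lower_bound[OF sl(2) w assms(3)] vs by simp
qed

section \<open>Termination of firing without the bank\<close>

text \<open>Induction backwards along a path to the bank, which fires 0 times. The total is
  conserved and the other entries are bounded below, so \<open>y\<close> never holds more than
  \<open>M\<close> chips. Each firing of \<open>x\<close> puts a chip on \<open>y\<close>, and
  \<open>y\<close> fires at most \<open>B\<close> times, so \<open>x\<close> cannot fire too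
  often.\<close>

lemma semilegal_count_bound:
  assumes "w \<in> verts G"
  shows "\<exists>B. \<forall>vs. semilegal c vs \<and> bank \<notin> set vs \<longrightarrow> count_list vs w \<le> B"
proof -
  have "w \<rightarrow>\<^sup>*\<^bsub>G\<^esub> bank"
    using assms strongly_connected bank_in_verts by (auto simp: strongly_connected_def)
  then show ?thesis
  proof (induction rule: converse_reachable_induct)
    case base
    have "\<forall>vs. semilegal c vs \<and> bank \<notin> set vs \<longrightarrow> count_list vs bank \<le> 0"
      by simp
    then show ?case by blast
  next
    case (step x y)
    obtain B where B: "\<And>vs. semilegal c vs \<Longrightarrow> bank \<notin> set vs \<Longrightarrow> count_list vs y \<le> B"
      using step.IH by blast
    define M where "M = (\<Sum>v\<in>verts G. c v) - (\<Sum>v\<in>verts G - {y}. min (c v) 0)"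
    have y: "y \<in> verts G"
      using step.hyps(1) by (rule adj_in_verts)
    have "count_list vs x \<le> nat (M - c y + outdeg y * int B)"
      if vs: "semilegal c vs" "bank \<notin> set vs" for vs
    proof -
      have sub: "set vs \<subseteq> verts G"
        using vs(1) by (rule semilegal_verts)
      \<comment> \<open>The bank satisfies the bound as well: it does not fire, so its entry does
        not decrease.\<close>
      have "fires c vs v \<ge> min (c v) 0" if "v \<in> verts G" for v
        using that semilegal_lower_bound[OF vs(1), of v]
          fires_nondecreasing[OF sub, of bank c] vs(2) bank_in_verts by (cases "v = bank") auto
      then have "(\<Sum>v\<in>verts G - {y}. min (c v) 0) \<le> (\<Sum>v\<in>verts G - {y}. fires c vs v)"
        by (intro sum_mono) auto
      moreover have "(\<Sum>v\<in>verts G. c v) = fires c vs y + (\<Sum>v\<in>verts G - {y}. fires c vs v)"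
        using sum_fires[OF sub, of c] y by (simp add: sum.remove)
      ultimately have "fires c vs y \<le> M"
        by (simp add: M_def)
      moreover have "fires c vs y \<ge> c y + int (count_list vs x) - outdeg y * int (count_list vs y)"
        by (rule fires_arc_lower_bound[OF sub step.hyps(1)])
      moreover have "outdeg y * int (count_list vs y) \<le> outdeg y * int B"
        using B[OF vs] outdeg_nonneg by (intro mult_left_mono) auto
      ultimately show ?thesis by linarith
    qed
    then show ?case by blast
  qed
qed

lemma semilegal_length_bound:
  "\<exists>B. \<forall>vs. semilegal c vs \<and> bank \<notin> set vs \<longrightarrow> length vs \<le> B"
proof -
  obtain B where B: "\<And>w vs. w \<in> verts G \<Longrightarrow> semilegal c vs \<Longrightarrow> bank \<notin> set vs \<Longrightarrow> count_list vs w \<le> B w"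
    using semilegal_count_bound[of _ c] by metis
  have "length vs \<le> (\<Sum>w\<in>verts G. B w)" if vs: "semilegal c vs" "bank \<notin> set vs" for vs
  proof -
    have "length vs = (\<Sum>w\<in>set vs. count_list vs w)"
      by (simp add: sum_count_set)
    also have "\<dots> \<le> (\<Sum>w\<in>verts G. count_list vs w)"
      using semilegal_verts[OF vs(1)] by (intro sum_mono2) auto
    also have "\<dots> \<le> (\<Sum>w\<in>verts G. B w)"
      using B vs by (intro sum_mono) auto
    finally show ?thesis .
  qed
  then show ?thesis by blast
qed

text \<open>The length bound provides a longest semilegal list without the bank. If its result were
  unstable, one more firing would extend it.\<close>

lemma stabilizing_seq_exists:
  obtains vs where "semilegal c vs" "bank \<notin> set vs" "stable G bank (fires c vs)"
proof -
  let ?P = "\<lambda>vs. semilegal c vs \<and> bank \<notin> set vs"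
  obtain B where B: "\<forall>vs. ?P vs \<longrightarrow> length vs \<le> B"
    using semilegal_length_bound by blast
  then obtain vs where vs: "?P vs" and max: "\<forall>ws. ?P ws \<longrightarrow> length ws \<le> length vs"
    using ex_has_greatest_nat[of ?P "[]" length "Suc B"] by (auto simp: less_Suc_eq_le)
  have "stable G bank (fires c vs)"
    unfolding stable_def
  proof (intro ballI impI, rule ccontr)
    fix v assume v: "v \<in> verts G" "v \<noteq> bank" "\<not> fires c vs v < outdeg v"
    then have "?P (vs @ [v])"
      using vs by (auto simp: semilegal_append)
    then show False
      using max by fastforce
  qed
  with vs that show ?thesis by blast
qed

section \<open>Least action and uniqueness of the stabilization\<close>

text \<open>The list \<open>ws\<close> need not be legal. Suppose \<open>u\<close> is the first
  vertex to exceed its count in \<open>ws\<close>. Just before, \<open>u\<close> has fired equally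
  often in both lists and all other vertices at most as often as in \<open>ws\<close>, so after
  \<open>ws\<close> the entry at \<open>u\<close> is at least as large. It is then still able to
  fire, against stability. Used in both directions, this makes the counts of two stabilizing lists
  agree.\<close>

lemma least_action:
  assumes "semilegal c vs" "bank \<notin> set vs"
    and "set ws \<subseteq> verts G" "stable G bank (fires c ws)"
  shows "count_list vs v \<le> count_list ws v"
  using assms(1,2)
proof (induction vs arbitrary: v rule: rev_induct)
  case (snoc u vs)
  have vs: "semilegal c vs" "bank \<notin> set vs" "set vs \<subseteq> verts G"
    and u: "u \<in> verts G" "u \<noteq> bank" "outdeg u \<le> fires c vs u"
    using snoc.prems semilegal_verts[of c vs] by (auto simp: semilegal_append)
  have le: "count_list vs v \<le> count_list ws v" for v
    using snoc.IH vs by simp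
  have "count_list vs u \<noteq> count_list ws u"
  proof
    assume eq: "count_list vs u = count_list ws u"
    have "laplacian G x u * int (count_list ws x) \<le> laplacian G x u * int (count_list vs x)" for x
      using eq le[of x] laplacian_nonpos[of x u] by (cases "x = u") (auto intro: mult_left_mono_neg)
    then have "fires c vs u \<le> fires c ws u"
      using assms(3) vs(3) u(1) by (simp add: fires_apply sum_mono)
    moreover have "fires c ws u < outdeg u"
      using assms(4) u by (simp add: stable_def)
    ultimately show False
      using u(3) by simp
  qed
  then show ?case
    using le[of v] le[of u] by auto
qed simp

lemma stabilizing_unique:
  assumes "c \<in> extensional (verts G)"
    and "semilegal c vs" "bank \<notin> set vs" "stable G bank (fires c vs)"
    and "semilegal c ws" "bank \<notin> set ws" "stable G bank (fires c ws)"
  shows "fires c vs = fires c ws"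
  using assms semilegal_verts by (intro fires_cong_count antisym least_action) auto

lemma stabilization_eqI:
  assumes "c \<in> extensional (verts G)"
    and "semilegal c vs" "bank \<notin> set vs" "stable G bank (fires c vs)"
  shows "stabilization G bank c = fires c vs"
  unfolding stabilization_def reachable_without_bank_eq
  using assms stabilizing_unique[OF assms(1)] by (intro the_equality) blast+

lemma stabilizationE:
  assumes "c \<in> extensional (verts G)"
  obtains vs where "semilegal c vs" "bank \<notin> set vs" "stable G bank (fires c vs)"
    "stabilization G bank c = fires c vs"
  using stabilizing_seq_exists[of c] stabilization_eqI[OF assms] by metis

lemma stable_stabilization:
  "c \<in> extensional (verts G) \<Longrightarrow> stable G bank (stabilization G bank c)"
  by (metis stabilizationE)

lemma stabilization_stable:
  "c \<in> extensional (verts G) \<Longrightarrow> stable G bank c \<Longrightarrow> stabilization G bank c = c"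
  using stabilization_eqI[of c "[]"] by simp

lemma stabilization_fires:
  assumes "c \<in> extensional (verts G)" "semilegal c vs" "bank \<notin> set vs"
  shows "stabilization G bank (fires c vs) = stabilization G bank c"
proof -
  obtain ws where "semilegal (fires c vs) ws" "bank \<notin> set ws" "stable G bank (fires (fires c vs) ws)"
    "stabilization G bank (fires c vs) = fires (fires c vs) ws"
    using stabilizationE[OF fires_extensional[OF assms(1)]] by metis
  then show ?thesis
    using stabilization_eqI[OF assms(1), of "vs @ ws"] assms(2,3) by (simp add: semilegal_append)
qed

text \<open>A firing of the bank only adds chips elsewhere, so the list \<open>vs\<close> that
  stabilizes \<open>c\<close> remains semilegal after it. By the abelian property the bank may as
  well fire after \<open>vs\<close>, that is, from the stabilization of \<open>c\<close>.\<close>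

lemma stabilization_fire_bank:
  assumes "c \<in> extensional (verts G)"
  shows "stabilization G bank (fire G c bank) = successor G bank (stabilization G bank c)"
proof -
  obtain vs where vs: "semilegal c vs" "bank \<notin> set vs" "stabilization G bank c = fires c vs"
    using stabilizationE[OF assms] by metis
  have sub: "set vs \<subseteq> verts G"
    using vs(1) by (rule semilegal_verts)
  have "fire G c bank v \<ge> c v" if "v \<in> set vs" "v \<noteq> bank" for v
    using that sub bank_in_verts laplacian_nonpos[of bank v] by (auto simp: fire_apply)
  then have "semilegal (fire G c bank) vs"
    using semilegal_mono[OF vs(1)] by blast
  then have "stabilization G bank (fire G c bank) = stabilization G bank (fires c (bank # vs))"
    using stabilization_fires[of "fire G c bank" vs] vs(2) by simp
  also have "fires c (bank # vs) = fires c (vs @ [bank])"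
    using sub bank_in_verts assms by (intro fires_cong_count) auto
  finally show ?thesis
    using vs(3) by (simp add: successor_def)
qed

subsection \<open>Merging orbits\<close>

text \<open>Orbits that meet share a tail. This relation will turn out to be equality of coevalence
  classes, but it can be handled before any orbit is known to be eventually periodic.\<close>

definition merges :: "('a \<Rightarrow> int) \<Rightarrow> ('a \<Rightarrow> int) \<Rightarrow> bool" where
  "merges c d \<longleftrightarrow> (\<exists>i j. (successor G bank ^^ i) (stabilization G bank c)
                        = (successor G bank ^^ j) (stabilization G bank d))"

lemma merges_refl [simp]: "merges c c"
  by (auto simp: merges_def)

lemma merges_sym: "merges c d \<Longrightarrow> merges d c"
  by (metis merges_def)

lemma merges_trans:
  assumes "merges c d" "merges d e"
  shows "merges c e"
proof -
  let ?s = "stabilization G bank" and ?f = "successor G bank"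
  obtain i j k l where ij: "(?f ^^ i) (?s c) = (?f ^^ j) (?s d)" and kl: "(?f ^^ k) (?s d) = (?f ^^ l) (?s e)"
    using assms by (auto simp: merges_def)
  \<comment> \<open>Both meetings are moved forward along the orbit of \<open>d\<close> to its
    iterate \<open>j + k\<close>.\<close>
  have "(?f ^^ (k + i)) (?s c) = (?f ^^ (k + j)) (?s d)"
    by (simp add: funpow_add ij)
  also have "\<dots> = (?f ^^ (j + k)) (?s d)"
    by (simp add: add.commute)
  also have "\<dots> = (?f ^^ (j + l)) (?s e)"
    by (simp add: funpow_add kl)
  finally show ?thesis
    by (auto simp: merges_def)
qed

lemma merges_semilegal:
  assumes "c \<in> extensional (verts G)" "semilegal c vs"
  shows "merges c (fires c vs)"
  using assms
proof (induction vs arbitrary: c)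
  case (Cons v vs)
  have "merges c (fire G c v)"
  proof (cases "v = bank")
    case True
    \<comment> \<open>After a firing of the bank the orbit merely starts one step later.\<close>
    have "(successor G bank ^^ 1) (stabilization G bank c)
        = (successor G bank ^^ 0) (stabilization G bank (fire G c bank))"
      using stabilization_fire_bank[OF Cons.prems(1)] by simp
    then show ?thesis
      unfolding merges_def True by blast
  next
    case False
    then have "stabilization G bank (fire G c v) = stabilization G bank c"
      using stabilization_fires[of c "[v]"] Cons.prems by simp
    then show ?thesis
      unfolding merges_def by metis
  qed
  moreover have "merges (fire G c v) (fires (fire G c v) vs)"
    using Cons by simp
  ultimately show ?case
    using merges_trans by simp
qed simp

section \<open>Making every vertex fire\<close>

lemma semilegal_replicate_bank: "semilegal c (replicate n bank)"
  using bank_in_verts by (induction n arbitrary: c) auto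

lemma semilegal_replicate:
  assumes "v \<in> verts G" "int n * outdeg v \<le> c v"
  shows "semilegal c (replicate n v)"
  using assms(2)
proof (induction n arbitrary: c)
  case (Suc n)
  have "outdeg v + int n * outdeg v \<le> c v"
    using Suc.prems by (simp add: algebra_simps)
  moreover have "0 \<le> int n * outdeg v"
    using outdeg_nonneg by simp
  moreover have "fire G c v v \<ge> c v - outdeg v"
    using assms(1) laplacian_diag_le[of v] by (simp add: fire_apply)
  ultimately show ?case
    using Suc.IH[of "fire G c v"] assms(1) by simp
qed simp

text \<open>Induction along a path from the bank, which may fire without limit. Enough firings of
  \<open>x\<close> supply \<open>y\<close> with the chips for its missing firings.\<close>

lemma semilegal_seq_fires_often:
  assumes "v \<in> verts G"
  shows "\<exists>vs. semilegal c vs \<and> count_list vs v \<ge> N"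
proof -
  have "bank \<rightarrow>\<^sup>*\<^bsub>G\<^esub> v"
    using assms strongly_connected bank_in_verts by (auto simp: strongly_connected_def)
  then show ?thesis
  proof (induction arbitrary: N rule: reachable_induct)
    case base
    then show ?case
      using semilegal_replicate_bank count_list_replicate by (metis order_refl)
  next
    case (step x y)
    have y: "y \<in> verts G"
      using step.hyps(2) by (rule adj_in_verts)
    \<comment> \<open>The \<open>k\<close> firings of \<open>y\<close> already in \<open>vs\<close>
      and the \<open>N - k\<close> still to come cost at most \<open>N * outdeg y\<close> together;
      the absolute value covers a possible debt of \<open>y\<close> at the start.\<close>
    obtain vs where vs: "semilegal c vs" "count_list vs x \<ge> nat (int N * outdeg y + \<bar>c y\<bar>)"
      using step.IH by blast
    define k where "k = count_list vs y"
    show ?case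
    proof (cases "N \<le> k")
      case True
      then show ?thesis
        using vs(1) k_def by blast
    next
      case False
      have "fires c vs y \<ge> c y + int (count_list vs x) - outdeg y * int k"
        unfolding k_def by (rule fires_arc_lower_bound[OF semilegal_verts[OF vs(1)] step.hyps(2)])
      then have "int (N - k) * outdeg y \<le> fires c vs y"
        using vs(2) False by (simp add: of_nat_diff algebra_simps)
      then have "semilegal c (vs @ replicate (N - k) y)"
        using vs(1) y by (simp add: semilegal_append semilegal_replicate)
      moreover have "count_list (vs @ replicate (N - k) y) y \<ge> N"
        by (simp add: count_list_replicate k_def)
      ultimately show ?thesis by blast
    qed
  qed
qed

lemma merges_fire:
  assumes "c \<in> extensional (verts G)" "v \<in> verts G"
  shows "merges c (fire G c v)"
proof -
  obtain vs where vs: "semilegal c vs" "count_list vs v \<ge> 1"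
    using semilegal_seq_fires_often[OF assms(2)] by blast
  then have "v \<in> set vs"
    by (metis count_notin not_one_le_zero)
  \<comment> \<open>Cutting at the first \<open>v\<close> keeps \<open>v\<close> out of
    \<open>xs\<close>, so firing \<open>v\<close> in advance lowers no entry needed by
    \<open>xs\<close>. From \<open>c\<close> via \<open>xs @ [v]\<close>, and from
    \<open>fire G c v\<close> via \<open>xs\<close>, the same configuration is reached.\<close>
  then obtain xs ys where split: "vs = xs @ v # ys" "v \<notin> set xs"
    using split_list_first by fast
  have sl: "semilegal c xs" "semilegal c (xs @ [v])"
    using vs(1) split(1) by (auto simp: semilegal_append)
  have sub: "set xs \<subseteq> verts G"
    using sl(1) by (rule semilegal_verts)
  have "c u \<le> fire G c v u" if "u \<in> set xs" for u
  proof -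
    have "u \<in> verts G" "v \<noteq> u"
      using that sub split(2) by auto
    then show ?thesis
      using assms(2) laplacian_nonpos by (simp add: fire_apply)
  qed
  then have "semilegal (fire G c v) xs"
    using semilegal_mono[OF sl(1)] by blast
  then have "merges (fire G c v) (fires c (v # xs))"
    using merges_semilegal[of "fire G c v" xs] by simp
  moreover have "fires c (v # xs) = fires c (xs @ [v])"
    using sub assms by (intro fires_cong_count) auto
  moreover have "merges c (fires c (xs @ [v]))"
    using assms(1) sl(2) by (rule merges_semilegal)
  ultimately show ?thesis
    using merges_sym merges_trans by metis
qed

lemma merges_fires:
  assumes "c \<in> extensional (verts G)" "set vs \<subseteq> verts G"
  shows "merges c (fires c vs)"
  using assms
proof (induction vs arbitrary: c)
  case (Cons v vs)
  then show ?case
    using merges_trans[OF merges_fire[of c v]] by simp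
qed simp

end

subsection \<open>Cosets of the Laplacian lattice\<close>

lemma carrier_int_vectors [simp]: "carrier (int_vectors G) = extensional (verts G)"
  by (auto simp: int_vectors_def PiE_def)

lemma mult_int_vectors [simp]: "x \<otimes>\<^bsub>int_vectors G\<^esub> y = (\<lambda>v\<in>verts G. x v + y v)"
  by (simp add: int_vectors_def)

lemma one_int_vectors [simp]: "\<one>\<^bsub>int_vectors G\<^esub> = (\<lambda>v\<in>verts G. 0)"
  by (simp add: int_vectors_def)

lemma group_int_vectors: "group (int_vectors G)"
  by (simp add: int_vectors_def)

lemma comm_group_int_vectors: "comm_group (int_vectors G)"
  by (rule group.group_comm_groupI[OF group_int_vectors]) (simp add: add.commute)

lemma inv_int_vectors:
  assumes "x \<in> extensional (verts G)"
  shows "inv\<^bsub>int_vectors G\<^esub> x = (\<lambda>v\<in>verts G. - x v)"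
  using assms by (intro group.inv_equality[OF group_int_vectors]) auto

lemma subgroup_int_vectorsI:
  assumes "H \<subseteq> extensional (verts G)" "(\<lambda>v\<in>verts G. 0) \<in> H"
    and "\<And>x y. x \<in> H \<Longrightarrow> y \<in> H \<Longrightarrow> (\<lambda>v\<in>verts G. x v + y v) \<in> H"
    and "\<And>x. x \<in> H \<Longrightarrow> (\<lambda>v\<in>verts G. - x v) \<in> H"
  shows "subgroup H (int_vectors G)"
proof (rule group.subgroupI[OF group_int_vectors])
  show "inv\<^bsub>int_vectors G\<^esub> x \<in> H" if "x \<in> H" for x
    using that assms inv_int_vectors[of x G] by auto
qed (use assms in auto)

lemma laplacian_transpose_mult_add:
  "laplacian_transpose_mult G (\<lambda>v\<in>verts G. x v + y v)
    = (\<lambda>w\<in>verts G. laplacian_transpose_mult G x w + laplacian_transpose_mult G y w)"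
  by (rule ext) (simp add: laplacian_transpose_mult_def ring_distribs sum.distrib)

lemma laplacian_transpose_mult_uminus:
  "laplacian_transpose_mult G (\<lambda>v\<in>verts G. - x v) = (\<lambda>w\<in>verts G. - laplacian_transpose_mult G x w)"
  by (rule ext) (simp add: laplacian_transpose_mult_def sum_negf)

lemma subgroup_laplacian_lattice: "subgroup (laplacian_lattice G) (int_vectors G)"
proof (rule subgroup_int_vectorsI)
  show "laplacian_lattice G \<subseteq> extensional (verts G)"
    by (auto simp: laplacian_lattice_def laplacian_transpose_mult_def)
  have "(\<lambda>v\<in>verts G. 0) = laplacian_transpose_mult G (\<lambda>v\<in>verts G. 0)"
    by (rule ext) (simp add: laplacian_transpose_mult_def)
  then show "(\<lambda>v\<in>verts G. 0) \<in> laplacian_lattice G"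
    unfolding laplacian_lattice_def by (intro image_eqI) auto
  show "(\<lambda>v\<in>verts G. x v + y v) \<in> laplacian_lattice G"
    if "x \<in> laplacian_lattice G" "y \<in> laplacian_lattice G" for x y
    using that unfolding laplacian_lattice_def
    by (auto simp flip: laplacian_transpose_mult_add)
  show "(\<lambda>v\<in>verts G. - x v) \<in> laplacian_lattice G" if "x \<in> laplacian_lattice G" for x
    using that unfolding laplacian_lattice_def
    by (auto simp flip: laplacian_transpose_mult_uminus)
qed

lemma subgroup_configurations: "subgroup (configurations G) (int_vectors G)"
  by (rule subgroup_int_vectorsI) (auto simp: configurations_def sum.distrib sum_negf)

abbreviation lattice_coset :: "('a, 'b) pre_digraph \<Rightarrow> ('a \<Rightarrow> int) \<Rightarrow> ('a \<Rightarrow> int) set" where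
  "lattice_coset G c \<equiv> laplacian_lattice G #>\<^bsub>int_vectors G\<^esub> c"

lemma lattice_coset_eq:
  assumes "c \<in> extensional (verts G)" "d \<in> lattice_coset G c"
  shows "lattice_coset G d = lattice_coset G c"
  using group.repr_independence[OF group_int_vectors assms(2) _ subgroup_laplacian_lattice] assms(1)
  by simp

lemma lattice_coset_extensional: "d \<in> lattice_coset G c \<Longrightarrow> d \<in> extensional (verts G)"
  by (auto simp: r_coset_def)

context chip_firing
begin

text \<open>The rows of the Laplacian \<open>Q\<close> sum to 0, so \<open>Q\<close> kills the
  all-ones vector, and pairing that vector with a combination of rows gives 0.\<close>

lemma lattice_sum_zero:
  assumes "l \<in> laplacian_lattice G"
  shows "(\<Sum>w\<in>verts G. l w) = 0"
proof -
  obtain x where x: "l = laplacian_transpose_mult G x"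
    using assms by (auto simp: laplacian_lattice_def)
  have "(\<Sum>w\<in>verts G. l w) = (\<Sum>w\<in>verts G. \<Sum>v\<in>verts G. laplacian G v w * x v)"
    by (simp add: x laplacian_transpose_mult_def)
  also have "\<dots> = (\<Sum>v\<in>verts G. (\<Sum>w\<in>verts G. laplacian G v w) * x v)"
    by (subst sum.swap) (simp add: sum_distrib_right)
  also have "\<dots> = 0"
    by (simp add: sum_laplacian_row)
  finally show ?thesis .
qed

lemma laplacian_lattice_subset: "laplacian_lattice G \<subseteq> configurations G"
  using lattice_sum_zero subgroup.subset[OF subgroup_laplacian_lattice[of G]]
  by (auto simp: configurations_def)

lemma lattice_coset_configuration:
  "c \<in> configurations G \<Longrightarrow> d \<in> lattice_coset G c \<Longrightarrow> d \<in> configurations G"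
  using lattice_sum_zero by (auto simp: r_coset_def configurations_def sum.distrib)

lemma lattice_coset_iff:
  "d \<in> lattice_coset G c \<longleftrightarrow> d \<in> extensional (verts G) \<and>
     (\<exists>x. \<forall>w\<in>verts G. d w = c w + (\<Sum>v\<in>verts G. laplacian G v w * x v))"
proof (intro iffI conjI)
  assume d: "d \<in> lattice_coset G c"
  then show "d \<in> extensional (verts G)"
    by (rule lattice_coset_extensional)
  show "\<exists>x. \<forall>w\<in>verts G. d w = c w + (\<Sum>v\<in>verts G. laplacian G v w * x v)"
    using d by (auto simp: r_coset_def laplacian_lattice_def laplacian_transpose_mult_def)
next
  assume "d \<in> extensional (verts G) \<and>
     (\<exists>x. \<forall>w\<in>verts G. d w = c w + (\<Sum>v\<in>verts G. laplacian G v w * x v))"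
  then obtain x where d: "d \<in> extensional (verts G)"
    and x: "\<And>w. w \<in> verts G \<Longrightarrow> d w = c w + (\<Sum>v\<in>verts G. laplacian G v w * x v)"
    by blast
  \<comment> \<open>Restricting \<open>x\<close> puts it into the carrier without changing the sum,
    which runs over vertices only.\<close>
  let ?l = "laplacian_transpose_mult G (restrict x (verts G))"
  have "d = (\<lambda>w\<in>verts G. ?l w + c w)"
    using d x by (intro extensionalityI[of _ "verts G"]) (auto simp: laplacian_transpose_mult_def)
  moreover have "?l \<in> laplacian_lattice G"
    by (auto simp: laplacian_lattice_def)
  ultimately show "d \<in> lattice_coset G c"
    by (auto simp: r_coset_def)
qed

lemma fires_in_lattice_coset:
  assumes "c \<in> extensional (verts G)" "set vs \<subseteq> verts G"
  shows "fires c vs \<in> lattice_coset G c"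
proof -
  have "\<forall>w\<in>verts G. fires c vs w = c w + (\<Sum>v\<in>verts G. laplacian G v w * - int (count_list vs v))"
    using assms(2) by (simp add: fires_apply sum_negf)
  then show ?thesis
    unfolding lattice_coset_iff using fires_extensional[OF assms(1)]
    by (intro conjI exI[of _ "\<lambda>v. - int (count_list vs v)"])
qed

text \<open>The coefficient vector is split into its positive and negative parts. Firing the
  positive part from \<open>d\<close> and the negative part from \<open>c\<close> gives the same
  vector, and by \<open>merges_fires\<close> neither list has to be legal.\<close>

lemma lattice_coset_imp_merges:
  assumes "c \<in> extensional (verts G)" "d \<in> lattice_coset G c"
  shows "merges c d"
proof -
  obtain x where d: "d \<in> extensional (verts G)"
    and x: "\<And>w. w \<in> verts G \<Longrightarrow> d w = c w + (\<Sum>v\<in>verts G. laplacian G v w * x v)"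
    using assms(2) unfolding lattice_coset_iff by blast
  obtain ps where ps: "set ps \<subseteq> verts G" "\<forall>v\<in>verts G. count_list ps v = nat (x v)"
    using list_with_counts_exists[OF finite_verts, of "\<lambda>v. nat (x v)"] by blast
  obtain ns where ns: "set ns \<subseteq> verts G" "\<forall>v\<in>verts G. count_list ns v = nat (- x v)"
    using list_with_counts_exists[OF finite_verts, of "\<lambda>v. nat (- x v)"] by blast
  have "fires d ps = fires c ns"
  proof (rule extensionalityI[OF fires_extensional[OF d] fires_extensional[OF assms(1)]])
    fix w assume w: "w \<in> verts G"
    have "fires d ps w = c w + (\<Sum>v\<in>verts G. laplacian G v w * (x v - int (count_list ps v)))"
      using ps(1) w x[OF w] by (simp add: fires_apply right_diff_distrib sum_subtractf)
    \<comment> \<open>An integer minus its positive part is the negative of its negative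
      part.\<close>
    also have "\<dots> = c w + (\<Sum>v\<in>verts G. laplacian G v w * - int (count_list ns v))"
      using ps(2) ns(2) by (intro arg_cong2[where f = "(+)"] sum.cong) auto
    also have "\<dots> = fires c ns w"
      using ns(1) w by (simp add: fires_apply sum_negf)
    finally show "fires d ps w = fires c ns w" .
  qed
  then show ?thesis
    using merges_fires[OF d ps(1)] merges_fires[OF assms(1) ns(1)] merges_sym merges_trans by metis
qed

lemma stabilization_in_lattice_coset:
  "c \<in> extensional (verts G) \<Longrightarrow> stabilization G bank c \<in> lattice_coset G c"
  by (metis stabilizationE fires_in_lattice_coset semilegal_verts)

lemma successor_in_lattice_coset:
  assumes "c \<in> extensional (verts G)"
  shows "successor G bank c \<in> lattice_coset G c"
proof -
  have "fire G c bank \<in> lattice_coset G c"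
    using fires_in_lattice_coset[OF assms, of "[bank]"] bank_in_verts by simp
  then show ?thesis
    using stabilization_in_lattice_coset[of "fire G c bank"] lattice_coset_eq[OF assms]
    by (simp add: successor_def)
qed

lemma successor_funpow_in_lattice_coset:
  assumes "c \<in> extensional (verts G)"
  shows "(successor G bank ^^ m) (stabilization G bank c) \<in> lattice_coset G c"
proof (induction m)
  case 0
  then show ?case
    using stabilization_in_lattice_coset[OF assms] by simp
next
  case (Suc m)
  then show ?case
    using successor_in_lattice_coset lattice_coset_eq[OF assms] lattice_coset_extensional
    by (metis funpow.simps(2) o_apply)
qed

text \<open>Each orbit stays inside its coset, so a common point identifies the cosets.\<close>

lemma merges_iff_lattice_coset:
  assumes "c \<in> extensional (verts G)" "d \<in> extensional (verts G)"
  shows "merges c d \<longleftrightarrow> lattice_coset G c = lattice_coset G d"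
proof
  assume "merges c d"
  then show "lattice_coset G c = lattice_coset G d"
    unfolding merges_def
    using successor_funpow_in_lattice_coset assms lattice_coset_eq by metis
next
  assume eq: "lattice_coset G c = lattice_coset G d"
  have "d \<in> lattice_coset G d"
    using group.rcos_self[OF group_int_vectors _ subgroup_laplacian_lattice] assms(2) by simp
  then show "merges c d"
    using lattice_coset_imp_merges[OF assms(1)] eq by simp
qed

subsection \<open>Critical configurations and coevalence classes\<close>

lemma configurations_extensional: "c \<in> configurations G \<Longrightarrow> c \<in> extensional (verts G)"
  by (simp add: configurations_def)

lemma successor_funpow_configuration:
  "c \<in> configurations G \<Longrightarrow> (successor G bank ^^ m) (stabilization G bank c) \<in> configurations G"
  using successor_funpow_in_lattice_coset lattice_coset_configuration configurations_extensional
  by metis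

lemma stable_successor: "stable G bank (successor G bank c)"
  by (simp add: successor_def stable_stabilization)

lemma stable_successor_funpow:
  "c \<in> extensional (verts G) \<Longrightarrow> stable G bank ((successor G bank ^^ m) (stabilization G bank c))"
  by (cases m) (simp_all add: stable_successor stable_stabilization)

text \<open>A whole successor step is a single semilegal run \<open>bank # vs\<close> from
  \<open>c\<close>. The bound survives iteration, so orbits are bounded below off the bank.\<close>

lemma successor_lower_bound:
  assumes "v \<in> verts G" "v \<noteq> bank"
  shows "successor G bank c v \<ge> min (c v) 0"
proof -
  obtain vs where vs: "semilegal (fire G c bank) vs" "successor G bank c = fires (fire G c bank) vs"
    using stabilizationE[of "fire G c bank"] by (metis successor_def fire_extensional)
  then have "semilegal c (bank # vs)" "successor G bank c = fires c (bank # vs)"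
    using bank_in_verts by simp_all
  then show ?thesis
    using semilegal_lower_bound assms by metis
qed

lemma successor_funpow_lower_bound:
  assumes "v \<in> verts G" "v \<noteq> bank"
  shows "(successor G bank ^^ m) c v \<ge> min (c v) 0"
proof (induction m)
  case (Suc m)
  then show ?case
    using successor_lower_bound[OF assms, of "(successor G bank ^^ m) c"] by simp
qed simp

text \<open>Stability bounds the entries off the bank from above, and the zero sum then confines the
  bank entry too. The bound \<open>b\<close> is kept general: it depends on the start when a single
  orbit is studied and is 0 when cosets are counted.\<close>

lemma finite_bounded_stable_configurations:
  "finite {c \<in> configurations G. stable G bank c \<and> (\<forall>v\<in>verts G - {bank}. b v \<le> c v)}"
    (is "finite ?S")
proof (rule finite_subset)
  let ?W = "verts G - {bank}"
  let ?I = "\<lambda>v. if v = bank then {- sum outdeg ?W .. - sum b ?W} else {b v .. outdeg v}"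
  show "?S \<subseteq> PiE (verts G) ?I"
  proof
    fix c assume "c \<in> ?S"
    then have c: "c \<in> extensional (verts G)" "sum c (verts G) = 0"
      and lo: "\<And>v. v \<in> ?W \<Longrightarrow> b v \<le> c v" and hi: "\<And>v. v \<in> ?W \<Longrightarrow> c v \<le> outdeg v"
      by (auto simp: configurations_def stable_def intro: less_imp_le)
    have "c bank = - sum c ?W"
      using c(2) bank_in_verts by (simp add: sum.remove)
    moreover have "sum b ?W \<le> sum c ?W" "sum c ?W \<le> sum outdeg ?W"
      using lo hi by (auto intro: sum_mono)
    ultimately show "c \<in> PiE (verts G) ?I"
      using c(1) lo hi by (auto simp: PiE_def)
  qed
  show "finite (PiE (verts G) ?I)"
    by (rule finite_PiE) auto
qed

lemma successor_orbit_repeats: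
  assumes "c \<in> configurations G"
  obtains i k where "k \<ge> 1"
    "(successor G bank ^^ (k + i)) (stabilization G bank c) = (successor G bank ^^ i) (stabilization G bank c)"
proof -
  let ?s = "stabilization G bank c"
  let ?orb = "\<lambda>m. (successor G bank ^^ m) ?s"
  have "range ?orb \<subseteq> {d \<in> configurations G. stable G bank d \<and> (\<forall>v\<in>verts G - {bank}. min (?s v) 0 \<le> d v)}"
    using successor_funpow_configuration[OF assms] successor_funpow_lower_bound
      stable_successor_funpow[OF configurations_extensional[OF assms]] by auto
  then have "finite (range ?orb)"
    by (rule finite_subset) (rule finite_bounded_stable_configurations)
  then have "\<not> inj ?orb"
    using finite_imageD[of ?orb UNIV] infinite_UNIV_nat by blast
  then obtain i j where "?orb i = ?orb j" "i < j"
    unfolding inj_def by (metis linorder_neqE_nat)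
  then show ?thesis
    using that[of "j - i" i] by simp
qed

text \<open>Once an orbit has repeated a value at distance \<open>k\<close>, every later iterate
  returns to itself after \<open>k\<close> steps.\<close>

lemma eventually_critical:
  assumes "c \<in> configurations G"
  obtains m0 where "\<And>m. m \<ge> m0 \<Longrightarrow> (successor G bank ^^ m) (stabilization G bank c) \<in> critical G bank"
proof -
  let ?s = "stabilization G bank c"
  obtain i k where k: "k \<ge> 1" and eq: "(successor G bank ^^ (k + i)) ?s = (successor G bank ^^ i) ?s"
    using successor_orbit_repeats[OF assms] .
  have "(successor G bank ^^ m) ?s \<in> critical G bank" if "m \<ge> i" for m
  proof -
    define n where "n = m - i"
    then have m: "m = n + i"
      using that by simp
    have "(successor G bank ^^ k) ((successor G bank ^^ m) ?s) = (successor G bank ^^ (k + (n + i))) ?s"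
      unfolding m by (rule funpow_add_apply[symmetric])
    also have "k + (n + i) = n + (k + i)"
      by simp
    also have "(successor G bank ^^ (n + (k + i))) ?s = (successor G bank ^^ m) ?s"
      unfolding m funpow_add_apply[of n] eq ..
    finally have "(successor G bank ^^ k) ((successor G bank ^^ m) ?s) = (successor G bank ^^ m) ?s" .
    moreover have "stable G bank ((successor G bank ^^ m) ?s)"
      by (rule stable_successor_funpow[OF configurations_extensional[OF assms]])
    ultimately show ?thesis
      using k successor_funpow_configuration[OF assms, of m] unfolding critical_def by blast
  qed
  then show ?thesis
    using that by blast
qed

lemma successor_funpow_critical:
  assumes "a \<in> critical G bank"
  shows "(successor G bank ^^ m) a \<in> critical G bank"
proof -
  obtain k where a: "a \<in> configurations G" "stable G bank a" and k: "k \<ge> 1" "(successor G bank ^^ k) a = a"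
    using assms by (auto simp: critical_def)
  \<comment> \<open>This makes the facts on orbits of stabilizations available for the orbit of
    \<open>a\<close> itself.\<close>
  have "stabilization G bank a = a"
    using a configurations_extensional stabilization_stable by blast
  then have "(successor G bank ^^ m) a \<in> configurations G" "stable G bank ((successor G bank ^^ m) a)"
    using successor_funpow_configuration[OF a(1), of m]
      stable_successor_funpow[OF configurations_extensional[OF a(1)], of m] by simp_all
  moreover have "(successor G bank ^^ k) ((successor G bank ^^ m) a) = (successor G bank ^^ m) a"
    by (metis add.commute comp_apply funpow_add k(2))
  ultimately show ?thesis
    using k(1) by (auto simp: critical_def)
qed

lemma equiv_coeval: "equiv (critical G bank) (coeval G bank)"
proof (rule equivI)
  show "coeval G bank \<subseteq> critical G bank \<times> critical G bank"
    by (auto simp: coeval_def)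
  show "refl_on (critical G bank) (coeval G bank)"
    by (auto simp: refl_on_def coeval_def intro: exI[of _ 0])
  show "sym (coeval G bank)"
  proof (rule symI)
    fix a b assume "(a, b) \<in> coeval G bank"
    then obtain m where ab: "a \<in> critical G bank" "b \<in> critical G bank" and m: "(successor G bank ^^ m) a = b"
      by (auto simp: coeval_def)
    obtain k where k: "k \<ge> 1" "(successor G bank ^^ k) a = a"
      using ab(1) by (auto simp: critical_def)
    have per: "(successor G bank ^^ (k * n)) a = a" for n
      using k(2) by (induction n) (simp_all add: funpow_add)
    \<comment> \<open>From \<open>b\<close> one goes on around the cycle until \<open>m\<close> full
      periods since \<open>a\<close> are complete; \<open>k \<ge> 1\<close> ensures
      \<open>m \<le> k * m\<close>.\<close>
    have "(successor G bank ^^ (k * m - m)) b = (successor G bank ^^ (k * m - m + m)) a"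
      by (simp add: funpow_add m)
    also have "\<dots> = a"
      using k(1) per[of m] by simp
    finally show "(b, a) \<in> coeval G bank"
      using ab by (auto simp: coeval_def)
  qed
  show "trans (coeval G bank)"
  proof (rule transI)
    fix a b c assume "(a, b) \<in> coeval G bank" "(b, c) \<in> coeval G bank"
    then obtain m n where "a \<in> critical G bank" "c \<in> critical G bank"
      "(successor G bank ^^ (n + m)) a = c"
      by (auto simp: coeval_def funpow_add)
    then show "(a, c) \<in> coeval G bank"
      by (auto simp: coeval_def)
  qed
qed

section \<open>The class attached to a configuration\<close>

text \<open>Justifies the definite description: two classes containing tails of one orbit share a
  point, and distinct classes are disjoint.\<close>

lemma coevalence_class_eqI:
  assumes "C \<in> coevalence_classes G bank"
    and "\<And>m. m \<ge> m0 \<Longrightarrow> (successor G bank ^^ m) (stabilization G bank c) \<in> C"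
  shows "coevalence_class G bank c = C"
  unfolding coevalence_class_def
proof (rule the_equality)
  fix D assume D: "D \<in> coevalence_classes G bank \<and>
    (\<exists>m0. \<forall>m\<ge>m0. (successor G bank ^^ m) (stabilization G bank c) \<in> D)"
  then obtain m1 where m1: "\<And>m. m \<ge> m1 \<Longrightarrow> (successor G bank ^^ m) (stabilization G bank c) \<in> D"
    by blast
  have "(successor G bank ^^ (max m0 m1)) (stabilization G bank c) \<in> C \<inter> D"
    using assms(2) m1 by simp
  then show "D = C"
    using quotient_disj[OF equiv_coeval] D assms(1) unfolding coevalence_classes_def by blast
qed (use assms in blast)

lemma coevalence_class_eventually:
  assumes "c \<in> configurations G"
  obtains m0 where "coevalence_class G bank c \<in> coevalence_classes G bank"
    "\<And>m. m \<ge> m0 \<Longrightarrow> (successor G bank ^^ m) (stabilization G bank c) \<in> coevalence_class G bank c"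
proof -
  let ?orb = "\<lambda>m. (successor G bank ^^ m) (stabilization G bank c)"
  obtain m0 where m0: "\<And>m. m \<ge> m0 \<Longrightarrow> ?orb m \<in> critical G bank"
    using eventually_critical[OF assms] by blast
  define C where "C = coeval G bank `` {?orb m0}"
  have C: "C \<in> coevalence_classes G bank"
    unfolding C_def coevalence_classes_def using m0 by (intro quotientI) simp
  have orb: "?orb m \<in> C" if "m \<ge> m0" for m
  proof -
    have "(successor G bank ^^ (m - m0)) (?orb m0) = ?orb m"
      using that by (simp flip: funpow_add_apply)
    then show ?thesis
      using m0 that by (auto simp: C_def coeval_def)
  qed
  show ?thesis
    using that coevalence_class_eqI[OF C orb] C orb by metis
qed

lemma coevalence_class_eq_iff_merges:
  assumes "c \<in> configurations G" "d \<in> configurations G"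
  shows "coevalence_class G bank c = coevalence_class G bank d \<longleftrightarrow> merges c d"
proof -
  let ?orb = "\<lambda>c m. (successor G bank ^^ m) (stabilization G bank c)"
  obtain m where C: "coevalence_class G bank c \<in> coevalence_classes G bank"
    and m: "\<And>k. k \<ge> m \<Longrightarrow> ?orb c k \<in> coevalence_class G bank c"
    using coevalence_class_eventually[OF assms(1)] by blast
  obtain n where n: "\<And>k. k \<ge> n \<Longrightarrow> ?orb d k \<in> coevalence_class G bank d"
    using coevalence_class_eventually[OF assms(2)] by blast
  show ?thesis
  proof
    assume "coevalence_class G bank c = coevalence_class G bank d"
    then have "(?orb c m, ?orb d n) \<in> coeval G bank"
      using m n C quotient_eq_iff[OF equiv_coeval] unfolding coevalence_classes_def
      by (metis order_refl)
    then obtain k where "(successor G bank ^^ k) (?orb c m) = ?orb d n"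
      by (auto simp: coeval_def)
    then have "?orb c (k + m) = ?orb d n"
      by (simp add: funpow_add)
    then show "merges c d"
      unfolding merges_def by blast
  next
    assume "merges c d"
    then obtain i j where ij: "?orb c i = ?orb d j"
      by (auto simp: merges_def)
    \<comment> \<open>The part \<open>j\<close> of the bound allows a transfer to the orbit of
      \<open>c\<close> at the meeting point; the part \<open>m\<close> places the resulting index in
      the tail inside the class.\<close>
    have "?orb d k \<in> coevalence_class G bank c" if "k \<ge> j + m" for k
    proof -
      have "?orb d k = (successor G bank ^^ (k - j)) (?orb d j)"
        using that by (simp flip: funpow_add_apply)
      also have "\<dots> = ?orb c (k - j + i)"
        by (simp add: funpow_add ij)
      finally show ?thesis
        using m[of "k - j + i"] that by simp
    qed
    then show "coevalence_class G bank c = coevalence_class G bank d"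
      using coevalence_class_eqI[OF C] by metis
  qed
qed

text \<open>Any member of a class represents it: being stable, it is its own stabilization, and its
  orbit stays in the class from index 0 on.\<close>

lemma coevalence_class_surj:
  assumes "C \<in> coevalence_classes G bank"
  obtains a where "a \<in> configurations G" "coevalence_class G bank a = C"
proof -
  obtain a where a: "a \<in> critical G bank" "C = coeval G bank `` {a}"
    using assms by (auto simp: coevalence_classes_def elim: quotientE)
  then have ac: "a \<in> configurations G" "stabilization G bank a = a"
    using configurations_extensional stabilization_stable by (auto simp: critical_def)
  have "(successor G bank ^^ m) a \<in> C" for m
    using a successor_funpow_critical by (auto simp: coeval_def)
  then show ?thesis
    using that[of a] ac coevalence_class_eqI[OF assms, of 0 a] by simp
qed

subsection \<open>The torsion subgroup\<close>

lemma semilegal_fires_all: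
  assumes "finite A" "A \<subseteq> verts G"
  shows "\<exists>vs. semilegal c vs \<and> A \<subseteq> set vs"
  using assms
proof (induction A)
  case empty
  have "semilegal c []"
    by simp
  then show ?case by blast
next
  case (insert a A)
  then obtain vs where vs: "semilegal c vs" "A \<subseteq> set vs"
    by blast
  obtain ws where ws: "semilegal (fires c vs) ws" "count_list ws a \<ge> 1"
    using semilegal_seq_fires_often insert.prems by blast
  have "a \<in> set ws"
    using ws(2) by (metis count_notin not_one_le_zero)
  then have "semilegal c (vs @ ws) \<and> insert a A \<subseteq> set (vs @ ws)"
    using vs ws(1) by (auto simp: semilegal_append)
  then show ?case by blast
qed

text \<open>Every vertex is fired once before stabilizing, so that \<open>semilegal_nonneg\<close>
  applies off the bank. The bound 0 is the same for all cosets, hence one finite set of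
  representatives serves them all.\<close>

lemma nonneg_stable_representative:
  assumes "c \<in> extensional (verts G)"
  obtains d where "d \<in> lattice_coset G c" "stable G bank d" "\<forall>v\<in>verts G - {bank}. 0 \<le> d v"
proof -
  obtain vs where vs: "semilegal c vs" "verts G \<subseteq> set vs"
    using semilegal_fires_all[OF finite_verts order_refl] by blast
  obtain ws where ws: "semilegal (fires c vs) ws" "stable G bank (fires (fires c vs) ws)"
    using stabilizing_seq_exists by blast
  have sl: "semilegal c (vs @ ws)"
    using vs ws by (simp add: semilegal_append)
  have "fires c (vs @ ws) v \<ge> 0" if "v \<in> verts G - {bank}" for v
    using semilegal_nonneg[OF sl] that vs(2) by auto
  then show ?thesis
    using that[of "fires c (vs @ ws)"] ws(2) fires_in_lattice_coset[OF assms semilegal_verts[OF sl]]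
    by simp
qed

lemma finite_configuration_cosets: "finite (lattice_coset G ` configurations G)"
proof (rule finite_subset)
  let ?S = "{c \<in> configurations G. stable G bank c \<and> (\<forall>v\<in>verts G - {bank}. 0 \<le> c v)}"
  show "lattice_coset G ` configurations G \<subseteq> lattice_coset G ` ?S"
  proof
    fix X assume "X \<in> lattice_coset G ` configurations G"
    then obtain c where c: "c \<in> configurations G" "X = lattice_coset G c"
      by blast
    obtain d where d: "d \<in> lattice_coset G c" "stable G bank d" "\<forall>v\<in>verts G - {bank}. 0 \<le> d v"
      using nonneg_stable_representative[OF configurations_extensional[OF c(1)]] .
    then have "d \<in> ?S"
      using lattice_coset_configuration[OF c(1)] by simp
    moreover have "X = lattice_coset G d"
      using lattice_coset_eq[OF configurations_extensional[OF c(1)] d(1)] c(2) by simp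
    ultimately show "X \<in> lattice_coset G ` ?S"
      by (intro image_eqI)
  qed
  show "finite (lattice_coset G ` ?S)"
    by (intro finite_imageI finite_bounded_stable_configurations)
qed

lemma normal_laplacian_lattice: "laplacian_lattice G \<lhd> int_vectors G"
  by (rule comm_group.subgroup_imp_normal[OF comm_group_int_vectors subgroup_laplacian_lattice])

lemma normal_laplacian_lattice_configurations:
  "laplacian_lattice G \<lhd> (int_vectors G)\<lparr>carrier := configurations G\<rparr>"
  using group.normal_restrict_supergroup[OF group_int_vectors subgroup_configurations
      normal_laplacian_lattice laplacian_lattice_subset] .

lemma group_full_critical_group: "group (full_critical_group G)"
  unfolding full_critical_group_def by (rule normal.factorgroup_is_group[OF normal_laplacian_lattice])

lemma subgroup_configuration_cosets:
  "subgroup (lattice_coset G ` configurations G) (full_critical_group G)"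
proof -
  have "lattice_coset G \<in> hom (int_vectors G) (full_critical_group G)"
    unfolding full_critical_group_def using normal.r_coset_hom_Mod[OF normal_laplacian_lattice] .
  then have "group_hom (int_vectors G) (full_critical_group G) (lattice_coset G)"
    by (simp add: group_hom_def group_hom_axioms_def group_int_vectors group_full_critical_group)
  then show ?thesis
    using group_hom.subgroup_img_is_subgroup subgroup_configurations by blast
qed

lemma sum_int_vectors_pow:
  "(\<Sum>v\<in>verts G. (c [^]\<^bsub>int_vectors G\<^esub> (n::nat)) v) = int n * (\<Sum>v\<in>verts G. c v)"
  by (induction n) (simp_all add: sum.distrib algebra_simps)

text \<open>The entry sum is additive and vanishes on the lattice, so a torsion coset has
  \<open>n\<close> times its sum equal to 0 and therefore sum 0. Conversely, the cosets of
  configurations form a finite group, in which the group order annihilates every element.\<close>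

lemma torsion_elements_full_critical_group:
  "torsion_elements (full_critical_group G) = lattice_coset G ` configurations G"
proof (intro equalityI subsetI)
  fix X assume "X \<in> torsion_elements (full_critical_group G)"
  then obtain n :: nat where X: "X \<in> carrier (full_critical_group G)"
    and n: "n > 0" "X [^]\<^bsub>full_critical_group G\<^esub> n = \<one>\<^bsub>full_critical_group G\<^esub>"
    by (auto simp: torsion_elements_def)
  obtain c where c: "c \<in> extensional (verts G)" "X = lattice_coset G c"
    using X by (auto simp: full_critical_group_def carrier_FactGroup)
  define d where "d = c [^]\<^bsub>int_vectors G\<^esub> n"
  have d: "d \<in> extensional (verts G)"
    using monoid.nat_pow_closed[OF group.is_monoid[OF group_int_vectors], of c G n] c(1)
    by (simp add: d_def)
  have "lattice_coset G d = laplacian_lattice G"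
    using n(2) c normal.FactGroup_pow[OF normal_laplacian_lattice, of c n]
    by (simp add: full_critical_group_def d_def)
  moreover have "d \<in> lattice_coset G d"
    using group.rcos_self[OF group_int_vectors _ subgroup_laplacian_lattice] d by simp
  ultimately have "(\<Sum>v\<in>verts G. d v) = 0"
    using lattice_sum_zero by simp
  then have "(\<Sum>v\<in>verts G. c v) = 0"
    using n(1) by (simp add: d_def sum_int_vectors_pow)
  then show "X \<in> lattice_coset G ` configurations G"
    using c by (auto simp: configurations_def)
next
  fix X assume X: "X \<in> lattice_coset G ` configurations G"
  let ?H = "(full_critical_group G)\<lparr>carrier := lattice_coset G ` configurations G\<rparr>"
  interpret H: group ?H
    by (rule subgroup.subgroup_is_group[OF subgroup_configuration_cosets group_full_critical_group])
  have fin: "finite (carrier ?H)"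
    using finite_configuration_cosets by simp
  have "X [^]\<^bsub>?H\<^esub> order ?H = \<one>\<^bsub>?H\<^esub>"
    using X by (intro H.pow_order_eq_1) simp
  \<comment> \<open>Powers use only the multiplication and the unit, which \<open>?H\<close> shares
    with the full group.\<close>
  then have "X [^]\<^bsub>full_critical_group G\<^esub> order ?H = \<one>\<^bsub>full_critical_group G\<^esub>"
    by (simp add: nat_pow_def)
  moreover have "order ?H > 0"
    using fin by (rule H.order_gt_0_iff_finite[THEN iffD2])
  moreover have "X \<in> carrier (full_critical_group G)"
    using X subgroup.subset[OF subgroup_configuration_cosets] by blast
  ultimately show "X \<in> torsion_elements (full_critical_group G)"
    by (auto simp: torsion_elements_def)
qed

lemma carrier_critical_group:
  "carrier (critical_group G) = lattice_coset G ` configurations G"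
  by (simp add: critical_group_def torsion_elements_full_critical_group)

text \<open>An equality of records: with the torsion elements known, the carriers agree, and the
  product of cosets is a product of sets that does not refer to the ambient carrier.\<close>

lemma critical_group_eq:
  "critical_group G = (int_vectors G)\<lparr>carrier := configurations G\<rparr> Mod laplacian_lattice G"
  unfolding critical_group_def torsion_elements_full_critical_group
  by (auto simp: full_critical_group_def FactGroup_def RCOSETS_def r_coset_def set_mult_def fun_eq_iff)

lemma coevalence_class_bijection:
  "\<exists>\<phi>. (\<forall>u\<in>configurations G. \<phi> (lattice_coset G u) = coevalence_class G bank u) \<and>
       bij_betw \<phi> (lattice_coset G ` configurations G) (coevalence_classes G bank)"
proof -
  \<comment> \<open>The choice of representative is harmless: \<open>coset_iff\<close> read from
    left to right gives well-definedness, and from right to left injectivity.\<close>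
  define \<phi> where "\<phi> X = coevalence_class G bank (SOME x. x \<in> X)" for X
  have coset_iff: "lattice_coset G u = lattice_coset G v
      \<longleftrightarrow> coevalence_class G bank u = coevalence_class G bank v"
    if "u \<in> configurations G" "v \<in> configurations G" for u v
    using that
    by (simp add: merges_iff_lattice_coset coevalence_class_eq_iff_merges configurations_extensional)
  have \<phi>: "\<phi> (lattice_coset G u) = coevalence_class G bank u" if u: "u \<in> configurations G" for u
  proof -
    have "u \<in> lattice_coset G u"
      using group.rcos_self[OF group_int_vectors _ subgroup_laplacian_lattice]
        configurations_extensional[OF u] by simp
    then have x: "(SOME x. x \<in> lattice_coset G u) \<in> lattice_coset G u" 
      by (rule someI[where P = "\<lambda>x. x \<in> lattice_coset G u"])
    then show ?thesis
      unfolding \<phi>_def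
      using coset_iff[OF lattice_coset_configuration[OF u x] u]
        lattice_coset_eq[OF configurations_extensional[OF u] x] by simp
  qed
  have "bij_betw \<phi> (lattice_coset G ` configurations G) (coevalence_classes G bank)"
  proof (rule bij_betwI')
    fix X Y assume "X \<in> lattice_coset G ` configurations G" "Y \<in> lattice_coset G ` configurations G"
    then obtain u v where "u \<in> configurations G" "X = lattice_coset G u"
      "v \<in> configurations G" "Y = lattice_coset G v"
      by blast
    then show "\<phi> X = \<phi> Y \<longleftrightarrow> X = Y"
      using \<phi> coset_iff by simp
  next
    fix X assume "X \<in> lattice_coset G ` configurations G"
    then obtain u where u: "u \<in> configurations G" "X = lattice_coset G u"
      by blast
    then show "\<phi> X \<in> coevalence_classes G bank"
      using \<phi> coevalence_class_eventually[OF u(1)] by simp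
  next
    fix C assume "C \<in> coevalence_classes G bank"
    then obtain u where "u \<in> configurations G" "coevalence_class G bank u = C"
      using coevalence_class_surj by blast
    then show "\<exists>X\<in>lattice_coset G ` configurations G. C = \<phi> X"
      using \<phi> by blast
  qed
  with \<phi> show ?thesis by blast
qed

end

text \<open>Well-definedness is expressed by one function on cosets whose value is prescribed for
  every representative in \<open>U\<close>.\<close>

theorem theorem9p8:
  fixes G :: "('a, 'b) pre_digraph" and bank :: 'a and U :: "('a \<Rightarrow> int) set"
  assumes "fin_digraph G"
    and "loopfree_digraph G"
    and "strongly_connected G"
    and "bank \<in> verts G"
    and U_def: "U = {u \<in> carrier (int_vectors G). (\<Sum>v\<in>verts G. u v) = 0}"
  shows "laplacian_lattice G \<lhd> (int_vectors G)\<lparr>carrier := U\<rparr> \<and>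
    subgroup (carrier (critical_group G)) (full_critical_group G) \<and>
    critical_group G = (int_vectors G)\<lparr>carrier := U\<rparr> Mod laplacian_lattice G \<and>
    (\<exists>\<phi>. (\<forall>u\<in>U. \<phi> (laplacian_lattice G #>\<^bsub>int_vectors G\<^esub> u) = coevalence_class G bank u) \<and>
         bij_betw \<phi> (carrier (critical_group G)) (coevalence_classes G bank))"
proof -
  interpret chip_firing G bank
    using assms(1,3,4) by (simp add: chip_firing_def chip_firing_axioms_def)
  have U: "U = configurations G"
    by (simp only: U_def configurations_def)
  show ?thesis
    unfolding U carrier_critical_group
    using normal_laplacian_lattice_configurations subgroup_configuration_cosets critical_group_eq
      coevalence_class_bijection by blast
qed

end
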